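(* For every integer $n\ge 81$ there is a bipartite graph with $n$ vertices that is a unit rectangle visibility graph and has at least $4n-8\lceil\sqrt{n}\,\rceil+4$ edges.
   Context: A finite simple graph $G$ is a unit rectangle visibility graph (URVG) if its vertices $v$ can be represented by closed unit squares $S_v$ in the plane with sides parallel to the coordinate axes and with pairwise disjoint interiors (squares may touch along their boundaries), in such a way that two distinct vertices $v,w$ are adjacent if and only if there is an unobstructed non-degenerate (positive width) horizontal or vertical band of visibility joining $S_v$ and $S_w$. Here a horizontal band of visibility joining $S_v$ and $S_w$ is given by an open interval $I$ of positive length such that for every $y_0\in I$ the line $y=y_0$ meets the interiors of both $S_v$ and $S_w$, and the part of this line between $S_v$ and $S_w$ (possibly a single point if the squares touch) meets the interior of no other square of the representation; vertical bands are defined analogously with the roles of $x$ and $y$ exchanged. *)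

theory Defs
  imports "HOL-Analysis.Analysis"
begin

definition simple_graph :: "'a set \<Rightarrow> 'a set set \<Rightarrow> bool" where
  "simple_graph V E \<longleftrightarrow> finite V \<and> (\<forall>e\<in>E. e \<subseteq> V \<and> card e = 2)"

definition bipartite :: "'a set \<Rightarrow> 'a set set \<Rightarrow> bool" where
  "bipartite V E \<longleftrightarrow>
     (\<exists>A B. A \<union> B = V \<and> A \<inter> B = {} \<and> (\<forall>e\<in>E. \<exists>a\<in>A. \<exists>b\<in>B. e = {a, b}))"

definition unit_square :: "real \<times> real \<Rightarrow> (real \<times> real) set" where
  "unit_square c = cbox c (c + (1, 1))"

definition line_at_height :: "real \<Rightarrow> (real \<times> real) set" where
  "line_at_height y = {q. snd q = y}"

text \<open>
  The unit squares are given by their lower left corners.  The function \<open>between_at_height\<close> is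
  only used at heights \<open>y\<close> where the horizontal line meets the interiors of two squares with
  disjoint interiors; the line then runs from the right side of the left square to the left side
  of the right one.  Both endpoints are included, so touching squares yield a single point.
\<close>

definition between_at_height ::
    "real \<times> real \<Rightarrow> real \<times> real \<Rightarrow> real \<Rightarrow> (real \<times> real) set" where
  "between_at_height c d y = {min (fst c) (fst d) + 1 .. max (fst c) (fst d)} \<times> {y}"

definition horizontal_visibility :: "'a set \<Rightarrow> ('a \<Rightarrow> real \<times> real) \<Rightarrow> 'a \<Rightarrow> 'a \<Rightarrow> bool" where
  "horizontal_visibility V p v w \<longleftrightarrow>
     (\<exists>a b. a < b \<and>
       (\<forall>y\<in>{a<..<b}.
          line_at_height y \<inter> interior (unit_square (p v)) \<noteq> {} \<and>
          line_at_height y \<inter> interior (unit_square (p w)) \<noteq> {} \<and>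
          (\<forall>u\<in>V - {v, w}.
             between_at_height (p v) (p w) y \<inter> interior (unit_square (p u)) = {})))"

text \<open>Reflecting the plane in the diagonal exchanges the two coordinates.\<close>

definition vertical_visibility :: "'a set \<Rightarrow> ('a \<Rightarrow> real \<times> real) \<Rightarrow> 'a \<Rightarrow> 'a \<Rightarrow> bool" where
  "vertical_visibility V p v w \<longleftrightarrow> horizontal_visibility V (prod.swap \<circ> p) v w"

definition unit_square_representation ::
    "'a set \<Rightarrow> 'a set set \<Rightarrow> ('a \<Rightarrow> real \<times> real) \<Rightarrow> bool" where
  "unit_square_representation V E p \<longleftrightarrow>
     pairwise (\<lambda>v w. interior (unit_square (p v)) \<inter> interior (unit_square (p w)) = {}) V \<and>
     (\<forall>v\<in>V. \<forall>w\<in>V. v \<noteq> w \<longrightarrow>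
        ({v, w} \<in> E \<longleftrightarrow> horizontal_visibility V p v w \<or> vertical_visibility V p v w))"

definition URVG :: "'a set \<Rightarrow> 'a set set \<Rightarrow> bool" where
  "URVG V E \<longleftrightarrow> simple_graph V E \<and> (\<exists>p. unit_square_representation V E p)"

end

theory Submission
  imports Defs
begin

text \<open>
  Place unit squares at the points of the lattice spanned by \<open>(3/2, -1/2)\<close> and \<open>(1/2, 3/2)\<close>.  In
  lattice coordinates a square sees exactly the squares that differ from it by \<open>\<plusminus>(1,0)\<close> and
  \<open>\<plusminus>(2,1)\<close> horizontally and \<open>\<plusminus>(0,1)\<close> and \<open>\<plusminus>(-1,2)\<close> vertically, so the infinite visibility graph is
  8-regular, and the checkerboard colouring of the coordinates is a bipartition.  Every horizontal
  and every vertical line meets the squares in an order that is monotone in each coordinate.  Hence,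
  when only the first \<open>n\<close> sites of a \<open>k \<times> k\<close> grid in row order are kept, no new visibility arises
  between squares of the same colour.  The edges lost at the boundary number at most
  \<open>k + k + (3 k - 2) + (3 k - 2) = 8 k - 4\<close>, one summand for each direction, and \<open>k = \<lceil>sqrt n\<rceil>\<close> will do.
\<close>

section \<open>Bands of visibility between unit squares\<close>

lemma mem_interior_unit_square:
  "q \<in> interior (unit_square c) \<longleftrightarrow>
     fst c < fst q \<and> fst q < fst c + 1 \<and> snd c < snd q \<and> snd q < snd c + 1"
proof -
  obtain x y where "c = (x, y)" by fastforce
  then show ?thesis
    by (cases q) (simp add: unit_square_def cbox_Pair_eq interior_Times)
qed

lemma line_meets_unit_square:
  "line_at_height y \<inter> interior (unit_square c) \<noteq> {} \<longleftrightarrow> snd c < y \<and> y < snd c + 1"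
proof
  assume "snd c < y \<and> y < snd c + 1"
  then have "(fst c + 1/2, y) \<in> line_at_height y \<inter> interior (unit_square c)"
    by (simp add: line_at_height_def mem_interior_unit_square)
  then show "line_at_height y \<inter> interior (unit_square c) \<noteq> {}" by blast
qed (auto simp: line_at_height_def mem_interior_unit_square)

lemma horizontal_visibility_commute:
  "horizontal_visibility V p v w \<longleftrightarrow> horizontal_visibility V p w v"
  unfolding horizontal_visibility_def between_at_height_def
  by (simp add: min.commute max.commute insert_commute conj_left_commute)

lemma vertical_visibility_commute:
  "vertical_visibility V p v w \<longleftrightarrow> vertical_visibility V p w v"
  unfolding vertical_visibility_def by (rule horizontal_visibility_commute)

text \<open>A square whose interior meets the segment between the two has its left side strictly
  between their left sides. As \<open>free\<close> ranges over all \<open>u\<close>, in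
  \<open>V\<close> or not, a visibility obtained this way holds in every vertex set.\<close>

lemma horizontal_visibilityI:
  assumes "a < b"
    and "snd (p v) \<le> a" "b \<le> snd (p v) + 1" "snd (p w) \<le> a" "b \<le> snd (p w) + 1"
    and "fst (p v) \<le> fst (p w)"
    and free: "\<And>u. fst (p v) < fst (p u) \<Longrightarrow> fst (p u) < fst (p w) \<Longrightarrow>
      a < snd (p u) + 1 \<Longrightarrow> snd (p u) < b \<Longrightarrow> False"
  shows "horizontal_visibility V p v w"
  unfolding horizontal_visibility_def
proof (intro exI conjI ballI)
  fix y u
  assume y: "y \<in> {a<..<b}"
  then show "line_at_height y \<inter> interior (unit_square (p v)) \<noteq> {}"
    and "line_at_height y \<inter> interior (unit_square (p w)) \<noteq> {}"
    using assms unfolding line_meets_unit_square by auto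
  show "between_at_height (p v) (p w) y \<inter> interior (unit_square (p u)) = {}"
    using free[of u] y \<open>fst (p v) \<le> fst (p w)\<close>
    by (fastforce simp: between_at_height_def mem_interior_unit_square)
qed fact

lemma horizontal_visibility_overlap:
  assumes "horizontal_visibility V p v w"
  shows "\<bar>snd (p v) - snd (p w)\<bar> < 1"
proof -
  obtain a b where "a < b" and *: "\<forall>y\<in>{a<..<b}.
      line_at_height y \<inter> interior (unit_square (p v)) \<noteq> {} \<and>
      line_at_height y \<inter> interior (unit_square (p w)) \<noteq> {}"
    using assms unfolding horizontal_visibility_def by blast
  from \<open>a < b\<close> obtain y where "y \<in> {a<..<b}" using dense by auto
  with * show ?thesis unfolding line_meets_unit_square by force
qed

text \<open>The lower half of the band between two squares at equal height is shut by \<open>u\<close>, the upper half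
  by \<open>u'\<close>.\<close>

lemma horizontal_visibility_blocked:
  assumes "horizontal_visibility V p v w" and "snd (p v) = snd (p w)"
    and "u \<in> V - {v, w}" "snd (p u) = snd (p v) - 1/2"
    and "fst (p v) + 1 \<le> fst (p u)" "fst (p u) + 1 \<le> fst (p w)"
    and "u' \<in> V - {v, w}" "snd (p u') = snd (p v) + 1/2"
    and "fst (p v) + 1 \<le> fst (p u')" "fst (p u') + 1 \<le> fst (p w)"
  shows False
proof -
  obtain a b where "a < b" and *: "\<And>y. y \<in> {a<..<b} \<Longrightarrow>
      snd (p v) < y \<and> y < snd (p v) + 1 \<and>
      (\<forall>u\<in>V - {v, w}. between_at_height (p v) (p w) y \<inter> interior (unit_square (p u)) = {})"
    using assms(1) unfolding horizontal_visibility_def line_meets_unit_square by blast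
  \<comment> \<open>Both blockers miss the height \<open>snd (p v) + 1/2\<close>, so another height
    in the band is needed.\<close>
  have "infinite {a<..<b}" using \<open>a < b\<close> by (rule infinite_Ioo)
  then have "\<not> {a<..<b} \<subseteq> {snd (p v) + 1/2}" using finite_subset by blast
  then obtain y where y: "y \<in> {a<..<b}" "y \<noteq> snd (p v) + 1/2" by blast
  have blocks: "\<not> (snd (p z) < y \<and> y < snd (p z) + 1)"
    if "z \<in> V - {v, w}" "fst (p v) + 1 \<le> fst (p z)" "fst (p z) + 1 \<le> fst (p w)" for z
  proof
    assume "snd (p z) < y \<and> y < snd (p z) + 1"
    with that have "(fst (p z) + 1/2, y) \<in>
        between_at_height (p v) (p w) y \<inter> interior (unit_square (p z))"
      by (simp add: between_at_height_def mem_interior_unit_square)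
    with * y(1) that(1) show False by blast
  qed
  show False
    using blocks[of u] blocks[of u'] assms(2-) *[OF y(1)] y(2) by auto
qed

section \<open>The lattice and its enumeration by rows\<close>

definition site :: "nat \<Rightarrow> nat \<Rightarrow> real \<times> real" where
  "site r q = ((3 * real r + real q) / 2, (3 * real q - real r) / 2)"

definition layout :: "nat \<Rightarrow> nat \<Rightarrow> real \<times> real" where
  "layout k t = site (t mod k) (t div k)"

lemma layout_index: "r < k \<Longrightarrow> layout k (q * k + r) = site r q"
  by (simp add: layout_def)

text \<open>Serves to locate blockers: a site before \<open>w\<close> in row order has a smaller
  index, hence is among the first \<open>n\<close> squares.\<close>

lemma grid_index_less:
  fixes r r' q q' k :: nat
  assumes "r < k" and "q < q' \<or> q = q' \<and> r < r'"
  shows "q * k + r < q' * k + r'"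
proof (cases "q < q'")
  case True
  then have "Suc q * k \<le> q' * k" by (intro mult_le_mono1) simp
  then show ?thesis using assms(1) by simp
qed (use assms in auto)

text \<open>Let (x, y) be the offset in lattice coordinates. If the interiors meet, the integers 3x
  + y and 3y - x are at most 1 in absolute value, while 10x = 3(3x + y) - (3y - x) and 10y = (3x +
  y) + 3(3y - x), so x = y = 0.\<close>

lemma site_interiors_disjoint:
  assumes "interior (unit_square (site r q)) \<inter> interior (unit_square (site r' q')) \<noteq> {}"
  shows "r = r' \<and> q = q'"
proof -
  obtain z where "z \<in> interior (unit_square (site r q))" "z \<in> interior (unit_square (site r' q'))"
    using assms by blast
  then have "3 * real r + real q < 3 * real r' + real q' + 2"
    "3 * real r' + real q' < 3 * real r + real q + 2"
    "3 * real q - real r < 3 * real q' - real r' + 2"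
    "3 * real q' - real r' < 3 * real q - real r + 2"
    unfolding mem_interior_unit_square site_def fst_conv snd_conv by argo+
  \<comment> \<open>Back to \<open>nat\<close>, with subtracted terms moved across: the conclusion
    needs integrality.\<close>
  then have "3 * r + q < 3 * r' + q' + 2" "3 * r' + q' < 3 * r + q + 2"
    "3 * q + r' < 3 * q' + r + 2" "3 * q' + r < 3 * q + r' + 2"
    by linarith+
  then have "r \<le> r'" "r' \<le> r" "q \<le> q'" "q' \<le> q" by linarith+
  then show ?thesis by simp
qed

lemma layout_pairwise_disjoint:
  "pairwise (\<lambda>v w. interior (unit_square (layout k v)) \<inter> interior (unit_square (layout k w)) = {}) V"
proof (rule pairwiseI)
  fix v w :: nat
  assume "v \<noteq> w"
  then have "\<not> (v mod k = w mod k \<and> v div k = w div k)"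
    by (metis div_mult_mod_eq)
  then show "interior (unit_square (layout k v)) \<inter> interior (unit_square (layout k w)) = {}"
    unfolding layout_def using site_interiors_disjoint by blast
qed

section \<open>The four directions of visibility\<close>

lemma horizontal_visibility_1_0:
  assumes "layout k v = site r q" "layout k w = site (Suc r) q"
  shows "horizontal_visibility V (layout k) v w"
proof (rule horizontal_visibilityI)
  \<comment> \<open>\<open>w\<close> lies half a unit below \<open>v\<close>, so the common heights
    are the lower half of \<open>v\<close>.\<close>
  let ?a = "(3 * real q - real r) / 2"
  show "?a < ?a + 1/2" by simp
  fix u
  define m l where "m = u mod k" and "l = u div k"
  assume "fst (layout k v) < fst (layout k u)" "fst (layout k u) < fst (layout k w)"
    "?a < snd (layout k u) + 1" "snd (layout k u) < ?a + 1/2"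
  then have "3 * real r + real q < 3 * real m + real l"
    "3 * real m + real l < 3 * real r + real q + 3"
    "3 * real q - real r < 3 * real l - real m + 2" "3 * real l - real m < 3 * real q - real r + 1"
    unfolding assms by (auto simp: layout_def site_def m_def l_def field_simps)
  then have *: "3 * r + q < 3 * m + l" "3 * m + l < 3 * r + q + 3"
    "3 * q + m < 3 * l + r + 2" "3 * l + r < 3 * q + m + 1"
    by linarith+
  \<comment> \<open>For the offset (x, y) of \<open>u\<close> from \<open>v\<close>, 3x + y is 1 or
    2 and 3y - x is -1 or 0, so 10y = (3x + y) + 3(3y - x) lies between -2 and 2.\<close>
  then have "l = q" by linarith
  with * have "r < m" "m < Suc r" by linarith+
  then show False by simp
qed (auto simp: assms site_def field_simps)

text \<open>Now \<open>w\<close> lies half a unit above \<open>v\<close>. A blocker at offset (x, y)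
  would have 3x + y in 1..6 and 3y - x in 0..1, so 10y would lie strictly between 0 and 10.\<close>

lemma horizontal_visibility_2_1:
  assumes "layout k v = site r q" "layout k w = site (r + 2) (Suc q)"
  shows "horizontal_visibility V (layout k) v w"
proof (rule horizontal_visibilityI)
  let ?a = "(3 * real q - real r + 1) / 2"
  show "?a < ?a + 1/2" by simp
  fix u
  define m l where "m = u mod k" and "l = u div k"
  assume "fst (layout k v) < fst (layout k u)" "fst (layout k u) < fst (layout k w)"
    "?a < snd (layout k u) + 1" "snd (layout k u) < ?a + 1/2"
  then have "3 * real r + real q < 3 * real m + real l"
    "3 * real m + real l < 3 * real r + real q + 7"
    "3 * real q - real r < 3 * real l - real m + 1" "3 * real l - real m < 3 * real q - real r + 2"
    unfolding assms by (auto simp: layout_def site_def m_def l_def field_simps)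
  then have "3 * r + q < 3 * m + l" "3 * m + l < 3 * r + q + 7"
    "3 * q + m < 3 * l + r + 1" "3 * l + r < 3 * q + m + 2"
    by linarith+
  then have "q < l" "l < Suc q" by linarith+
  then show False by simp
qed (auto simp: assms site_def field_simps)

lemma vertical_visibility_0_1:
  assumes "layout k v = site r q" "layout k w = site r (Suc q)"
  shows "vertical_visibility V (layout k) v w"
  unfolding vertical_visibility_def
proof (rule horizontal_visibilityI)
  let ?p = "prod.swap \<circ> layout k" and ?a = "(3 * real r + real q + 1) / 2"
  show "?a < ?a + 1/2" by simp
  fix u
  define m l where "m = u mod k" and "l = u div k"
  assume "fst (?p v) < fst (?p u)" "fst (?p u) < fst (?p w)"
    "?a < snd (?p u) + 1" "snd (?p u) < ?a + 1/2"
  then have "3 * real q - real r < 3 * real l - real m"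
    "3 * real l - real m < 3 * real q - real r + 3"
    "3 * real r + real q < 3 * real m + real l + 1" "3 * real m + real l < 3 * real r + real q + 2"
    unfolding assms o_apply by (auto simp: layout_def site_def m_def l_def field_simps)
  then have "3 * q + m < 3 * l + r" "3 * l + r < 3 * q + m + 3"
    "3 * r + q < 3 * m + l + 1" "3 * m + l < 3 * r + q + 2"
    by linarith+
  then have "q < l" "l < Suc q" by linarith+
  then show False by simp
qed (auto simp: assms site_def field_simps)

text \<open>Starting from \<open>Suc r\<close> avoids a subtraction for the direction (-1, 2). With
  offsets taken from \<open>site r q\<close>, a blocker would have 10x = 3(3x + y) - (3y - x)
  strictly between 0 and 10.\<close>

lemma vertical_visibility_1_2:
  assumes "layout k v = site (Suc r) q" "layout k w = site r (q + 2)"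
  shows "vertical_visibility V (layout k) v w"
  unfolding vertical_visibility_def
proof (rule horizontal_visibilityI)
  let ?p = "prod.swap \<circ> layout k" and ?a = "(3 * real r + real q + 3) / 2"
  show "?a < ?a + 1/2" by simp
  fix u
  define m l where "m = u mod k" and "l = u div k"
  assume "fst (?p v) < fst (?p u)" "fst (?p u) < fst (?p w)"
    "?a < snd (?p u) + 1" "snd (?p u) < ?a + 1/2"
  then have "3 * real q - real r - 1 < 3 * real l - real m"
    "3 * real l - real m < 3 * real q - real r + 6"
    "3 * real r + real q + 1 < 3 * real m + real l" "3 * real m + real l < 3 * real r + real q + 4"
    unfolding assms o_apply by (auto simp: layout_def site_def m_def l_def field_simps)
  then have "3 * q + m < 3 * l + r + 1" "3 * l + r < 3 * q + m + 6"
    "3 * r + q + 1 < 3 * m + l" "3 * m + l < 3 * r + q + 4"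
    by linarith+
  then have "r < m" "m < Suc r" by linarith+
  then show False by simp
qed (auto simp: assms site_def field_simps)

section \<open>Bipartition by the checkerboard colouring\<close>

definition colour :: "nat \<Rightarrow> nat \<Rightarrow> bool" where
  "colour k t \<longleftrightarrow> even (t mod k + t div k)"

text \<open>Overlap of heights bounds the doubled height difference by 1, and equal colours make it
  even, hence 0. The offset is then a positive multiple of (3, 1), and the neighbours of
  \<open>v\<close> in directions (1, 0) and (2, 1) close the band.\<close>

lemma horizontal_visibility_colour_aux:
  assumes "k > 0" "v < n" "w < n" "v \<noteq> w" and vis: "horizontal_visibility {..<n} (layout k) v w"
    and "v div k \<le> w div k"
  shows "colour k v \<noteq> colour k w"
proof
  assume same: "colour k v = colour k w"
  define r q r' q' where "r = v mod k" and "q = v div k" and "r' = w mod k" and "q' = w div k"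
  note defs = r_def q_def r'_def q'_def
  have v: "v = q * k + r" and w: "w = q' * k + r'" and "r < k" "r' < k"
    using \<open>k > 0\<close> by (simp_all add: defs)
  have pv: "layout k v = site r q" and pw: "layout k w = site r' q'"
    by (simp_all add: layout_def defs)
  have "\<bar>(3 * real q - real r) - (3 * real q' - real r')\<bar> < 2"
    using horizontal_visibility_overlap[OF vis] by (simp add: pv pw site_def field_simps)
  then have "3 * q + r' < 3 * q' + r + 2" "3 * q' + r < 3 * q + r' + 2" by linarith+
  then have "3 * q + r' = 3 * q' + r \<or> 3 * q + r' = Suc (3 * q' + r) \<or> 3 * q' + r = Suc (3 * q + r')"
    by linarith
  moreover have "even (3 * q + r') \<longleftrightarrow> even (3 * q' + r)"
    using same by (auto simp: colour_def defs)
  ultimately have "3 * q + r' = 3 * q' + r" by (metis even_Suc)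
  moreover from this have "q \<noteq> q'" using \<open>v \<noteq> w\<close> v w by auto
  then have less: "q < q'" using \<open>v div k \<le> w div k\<close> unfolding q_def q'_def by simp
  ultimately obtain d where d: "q' = q + Suc d" "r' = r + 3 * Suc d"
    using less_imp_Suc_add[OF less] by auto
  \<comment> \<open>Both columns stay below \<open>r'\<close> and both sites precede
    \<open>w\<close> in row order, so neither has been cut off.\<close>
  let ?u = "q * k + Suc r" and ?u' = "Suc q * k + (r + 2)"
  have pu: "layout k ?u = site (Suc r) q" and pu': "layout k ?u' = site (r + 2) (Suc q)"
    using \<open>r' < k\<close> d by (intro layout_index; simp)+
  have "v < ?u" "?u < w" "v < ?u'" "?u' < w"
    unfolding v w using \<open>r < k\<close> \<open>r' < k\<close> d by (intro grid_index_less; auto)+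
  then have "?u \<in> {..<n} - {v, w}" "?u' \<in> {..<n} - {v, w}" using \<open>w < n\<close> by auto
  then show False
    using horizontal_visibility_blocked[OF vis, of ?u ?u']
    unfolding pv pw pu pu' by (simp add: site_def d field_simps)
qed

text \<open>The same argument in the other axis: the offset is a positive multiple of (-1, 3), and
  the blockers lie in directions (0, 1) and (-1, 2).\<close>

lemma vertical_visibility_colour_aux:
  assumes "k > 0" "v < n" "w < n" "v \<noteq> w" and vis: "vertical_visibility {..<n} (layout k) v w"
    and "v div k \<le> w div k"
  shows "colour k v \<noteq> colour k w"
proof
  assume same: "colour k v = colour k w"
  define r q r' q' where "r = v mod k" and "q = v div k" and "r' = w mod k" and "q' = w div k"
  note defs = r_def q_def r'_def q'_def
  have v: "v = q * k + r" and w: "w = q' * k + r'" and "r < k" "r' < k"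
    using \<open>k > 0\<close> by (simp_all add: defs)
  have pv: "layout k v = site r q" and pw: "layout k w = site r' q'"
    by (simp_all add: layout_def defs)
  note vis' = vis[unfolded vertical_visibility_def]
  have "\<bar>(3 * real r + real q) - (3 * real r' + real q')\<bar> < 2"
    using horizontal_visibility_overlap[OF vis'] by (simp add: pv pw site_def field_simps)
  then have "3 * r + q < 3 * r' + q' + 2" "3 * r' + q' < 3 * r + q + 2" by linarith+
  then have "3 * r + q = 3 * r' + q' \<or> 3 * r + q = Suc (3 * r' + q') \<or> 3 * r' + q' = Suc (3 * r + q)"
    by linarith
  moreover have "even (3 * r + q) \<longleftrightarrow> even (3 * r' + q')"
    using same by (auto simp: colour_def defs)
  ultimately have eq: "3 * r + q = 3 * r' + q'" by (metis even_Suc)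
  then have "r \<noteq> r'" using \<open>v \<noteq> w\<close> v w by auto
  moreover have "q \<le> q'" using \<open>v div k \<le> w div k\<close> unfolding q_def q'_def .
  ultimately have less: "r' < r" using eq by linarith
  with eq obtain d where d: "r = r' + Suc d" "q' = q + 3 * Suc d"
    using less_imp_Suc_add[OF less] by auto
  \<comment> \<open>The column \<open>r' + d\<close> is \<open>r - 1\<close>.\<close>
  let ?u' = "Suc q * k + r" and ?u = "(q + 2) * k + (r' + d)"
  have pu': "layout k ?u' = site r (Suc q)" and pu: "layout k ?u = site (r' + d) (q + 2)"
    using \<open>r < k\<close> d by (intro layout_index; simp)+
  have "v < ?u" "?u < w" "v < ?u'" "?u' < w"
    unfolding v w using \<open>r < k\<close> \<open>r' < k\<close> d by (intro grid_index_less; auto)+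
  then have "?u \<in> {..<n} - {v, w}" "?u' \<in> {..<n} - {v, w}" using \<open>w < n\<close> by auto
  then show False
    using horizontal_visibility_blocked[OF vis', of ?u ?u']
    unfolding o_apply pv pw pu pu' by (simp add: site_def d field_simps)
qed

section \<open>The visibility graph and its bipartition\<close>

definition visibility_edges :: "'a set \<Rightarrow> ('a \<Rightarrow> real \<times> real) \<Rightarrow> 'a set set" where
  "visibility_edges V p = {{v, w} |v w. v \<in> V \<and> w \<in> V \<and> v \<noteq> w \<and>
     (horizontal_visibility V p v w \<or> vertical_visibility V p v w)}"

lemma mem_visibility_edges:
  assumes "v \<in> V" "w \<in> V" "v \<noteq> w"
  shows "{v, w} \<in> visibility_edges V p \<longleftrightarrow>
    horizontal_visibility V p v w \<or> vertical_visibility V p v w"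
  using assms horizontal_visibility_commute[of V p v w] vertical_visibility_commute[of V p v w]
  unfolding visibility_edges_def by (simp add: doubleton_eq_iff) metis

lemma simple_graph_visibility_edges: "finite V \<Longrightarrow> simple_graph V (visibility_edges V p)"
  unfolding simple_graph_def visibility_edges_def by auto

lemma bipartite_visibility_edges:
  assumes "k > 0"
  shows "bipartite {..<n} (visibility_edges {..<n} (layout k))"
proof -
  let ?A = "{t. t < n \<and> colour k t}" and ?B = "{t. t < n \<and> \<not> colour k t}"
  \<comment> \<open>Visibility is symmetric, so the square with the smaller row number may be taken
    first.\<close>
  have "colour k v \<noteq> colour k w"
    if "v < n" "w < n" "v \<noteq> w" "horizontal_visibility {..<n} (layout k) v w \<or>
      vertical_visibility {..<n} (layout k) v w" for v w
    using that assms horizontal_visibility_commute vertical_visibility_commute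
      horizontal_visibility_colour_aux vertical_visibility_colour_aux
    by (metis nat_le_linear)
  then have "\<exists>a\<in>?A. \<exists>b\<in>?B. e = {a, b}" if "e \<in> visibility_edges {..<n} (layout k)" for e
    using that unfolding visibility_edges_def by (smt (verit) insert_commute lessThan_iff mem_Collect_eq)
  moreover have "?A \<union> ?B = {..<n}" "?A \<inter> ?B = {}" by auto
  ultimately show ?thesis unfolding bipartite_def by blast
qed

section \<open>Counting the edges\<close>

text \<open>The index distances \<open>1\<close>, \<open>k\<close>, \<open>k + 2\<close>, \<open>2 k - 1\<close> belong to the directions \<open>(1,0)\<close>, \<open>(0,1)\<close>,
  \<open>(2,1)\<close>, \<open>(-1,2)\<close>; \<open>boundary k g\<close> collects the sites whose partner at distance \<open>g\<close> before them would
  leave the grid.\<close>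

definition boundary :: "nat \<Rightarrow> nat \<Rightarrow> nat set" where
  "boundary k g =
    (if g = 1 then (\<lambda>q. q * k) ` {..<k}
     else if g = k then {..<k}
     else if g = k + 2 then {..<k} \<union> (\<lambda>(q, r). q * k + r) ` ({1..<k} \<times> {..<2})
     else {..<2 * k} \<union> (\<lambda>q. q * k + (k - 1)) ` {2..<k})"

text \<open>Each edge is charged to its larger endpoint \<open>w\<close>; \<open>g \<le> w\<close>
  ensures that \<open>w - g\<close> is not truncated.\<close>

lemma visibility_edge_backwards:
  assumes "k \<ge> 4" "w < n" "n \<le> k\<^sup>2" "g \<in> {1, k, k + 2, 2 * k - 1}" "w \<notin> boundary k g"
  shows "g \<le> w \<and> {w - g, w} \<in> visibility_edges {..<n} (layout k)"
proof -
  define r q where "r = w mod k" and "q = w div k"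
  have w: "w = q * k + r" and "r < k" using \<open>k \<ge> 4\<close> by (simp_all add: r_def q_def)
  have "q < k"
    using assms by (auto simp: q_def power2_eq_square less_mult_imp_div_less)
  have pw: "layout k w = site r q" by (simp add: layout_def r_def q_def)
  have edge: "g \<le> w \<and> {w - g, w} \<in> visibility_edges {..<n} (layout k)"
    if "w = v + g" "horizontal_visibility {..<n} (layout k) v w \<or>
      vertical_visibility {..<n} (layout k) v w" for v
    using that assms(1,2,4) mem_visibility_edges[of v "{..<n}" w "layout k"] by auto
  consider "g = 1" | "g = k" | "g = k + 2" | "g = 2 * k - 1" using assms(4) by blast
  then show ?thesis
  proof cases
    case 1
    then have "r \<noteq> 0" using assms(5) \<open>q < k\<close> w by (auto simp: boundary_def)
    then obtain r0 where r: "r = Suc r0" by (auto simp: gr0_conv_Suc)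
    have "layout k (q * k + r0) = site r0 q" using \<open>r < k\<close> r by (intro layout_index) simp
    with pw r have "horizontal_visibility {..<n} (layout k) (q * k + r0) w"
      using horizontal_visibility_1_0 by simp
    then show ?thesis using edge[of "q * k + r0"] w r 1 by simp
  next
    case 2
    then have "w \<notin> {..<k}" using assms(1,5) by (simp add: boundary_def)
    then have "q \<noteq> 0" using \<open>r < k\<close> w by (metis add_0 lessThan_iff mult_0)
    then obtain q0 where q: "q = Suc q0" by (auto simp: gr0_conv_Suc)
    have "layout k (q0 * k + r) = site r q0" using \<open>r < k\<close> by (rule layout_index)
    with pw q have "vertical_visibility {..<n} (layout k) (q0 * k + r) w"
      using vertical_visibility_0_1 by simp
    then show ?thesis using edge[of "q0 * k + r"] w q 2 by simp
  next
    case 3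
    then have nb: "w \<notin> {..<k}" "w \<notin> (\<lambda>(q, r). q * k + r) ` ({1..<k} \<times> {..<2})"
      using assms(1,5) by (auto simp: boundary_def)
    then have "q \<noteq> 0" using \<open>r < k\<close> w by auto
    moreover have "\<not> r < 2" using nb(2) \<open>q \<noteq> 0\<close> \<open>q < k\<close> w by (force simp: image_iff)
    ultimately obtain q0 r0 where qr: "q = Suc q0" "r = r0 + 2"
      by (metis gr0_conv_Suc neq0_conv le_Suc_ex not_less add.commute)
    have "layout k (q0 * k + r0) = site r0 q0" using \<open>r < k\<close> qr by (intro layout_index) simp
    with pw qr have "horizontal_visibility {..<n} (layout k) (q0 * k + r0) w"
      using horizontal_visibility_2_1 by simp
    then show ?thesis using edge[of "q0 * k + r0"] w qr 3 by simp
  next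
    case 4
    \<comment> \<open>At \<open>k = 3\<close> the distances \<open>k + 2\<close> and
      \<open>2 * k - 1\<close> would coincide; \<open>k \<ge> 4\<close> selects the last branch of
      \<open>boundary\<close>.\<close>
    then have "g \<noteq> 1" "g \<noteq> k" "g \<noteq> k + 2" using assms(1) by linarith+
    with assms(5) have nb: "w \<notin> {..<2 * k}" "w \<notin> (\<lambda>q. q * k + (k - 1)) ` {2..<k}"
      by (simp_all add: boundary_def)
    have "\<not> q < 2"
    proof
      assume "q < 2"
      then have "w < 2 * k + 0" unfolding w using \<open>r < k\<close> by (intro grid_index_less) auto
      with nb(1) show False by simp
    qed
    then obtain q0 where q: "q = q0 + 2" by (metis le_Suc_ex not_less add.commute)
    have "r \<noteq> k - 1" using nb(2) \<open>\<not> q < 2\<close> \<open>q < k\<close> w by auto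
    with \<open>r < k\<close> have "layout k (q0 * k + Suc r) = site (Suc r) q0" by (intro layout_index) simp
    with pw q have "vertical_visibility {..<n} (layout k) (q0 * k + Suc r) w"
      using vertical_visibility_1_2 by simp
    moreover have "w = q0 * k + Suc r + g" using w q 4 \<open>k \<ge> 4\<close> by (simp add: algebra_simps)
    ultimately show ?thesis using edge by blast
  qed
qed

lemma card_boundary:
  assumes "k \<ge> 4"
  shows "finite (boundary k g)"
    and "card (boundary k 1) \<le> k" "card (boundary k k) \<le> k"
    and "card (boundary k (k + 2)) \<le> 3 * k - 2" "card (boundary k (2 * k - 1)) \<le> 3 * k - 2"
proof -
  show "finite (boundary k g)" by (simp add: boundary_def)
  show "card (boundary k 1) \<le> k"
    using card_image_le[of "{..<k}" "\<lambda>q. q * k"] by (simp add: boundary_def)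
  show "card (boundary k k) \<le> k" using assms by (simp add: boundary_def)
  \<comment> \<open>The counts k + 2(k - 1) here and 2k + (k - 2) below both equal 3k - 2.\<close>
  have "card ({..<k} \<union> (\<lambda>(q, r). q * k + r) ` ({1..<k} \<times> {..<2::nat})) \<le>
      card {..<k} + card ({1..<k} \<times> {..<2::nat})"
    by (intro order.trans[OF card_Un_le] add_mono card_image_le) auto
  then show "card (boundary k (k + 2)) \<le> 3 * k - 2"
    using assms by (simp add: boundary_def card_cartesian_product)
  have "card ({..<2 * k} \<union> (\<lambda>q. q * k + (k - 1)) ` {2..<k}) \<le> card {..<2 * k} + card {2..<k}"
    by (intro order.trans[OF card_Un_le] add_mono card_image_le) auto
  moreover have "2 * k - 1 \<noteq> 1" "2 * k - 1 \<noteq> k" "2 * k - 1 \<noteq> k + 2" using assms by linarith+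
  ultimately show "card (boundary k (2 * k - 1)) \<le> 3 * k - 2"
    using assms by (simp add: boundary_def)
qed

text \<open>An edge determines its larger endpoint and its index distance, so the four directions
  contribute disjoint sets of edges.\<close>

lemma card_visibility_edges:
  assumes "k \<ge> 4" "n \<le> k\<^sup>2"
  shows "4 * n + 4 \<le> card (visibility_edges {..<n} (layout k)) + 8 * k"
proof -
  let ?E = "visibility_edges {..<n} (layout k)"
  define gs where "gs = {1, k, k + 2, 2 * k - 1}"
  define D where "D = (SIGMA g:gs. {..<n} - boundary k g)"
  have edge: "g > 0 \<and> g \<le> w \<and> {w - g, w} \<in> ?E" if "(g, w) \<in> D" for g w
    using that visibility_edge_backwards[OF assms(1) _ assms(2), of w g] \<open>k \<ge> 4\<close>
    by (auto simp: D_def gs_def)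
  have "inj_on (\<lambda>(g, w). {w - g, w}) D"
  proof (rule inj_onI, clarify)
    fix g w g' w'
    assume "(g, w) \<in> D" "(g', w') \<in> D" "{w - g, w} = {w' - g', w'}"
    with edge[of g w] edge[of g' w'] show "g = g' \<and> w = w'"
      by (auto simp: doubleton_eq_iff)
  qed
  moreover have "(\<lambda>(g, w). {w - g, w}) ` D \<subseteq> ?E" using edge by auto
  moreover have "finite ?E"
    by (rule finite_subset[of _ "Pow {..<n}"]) (auto simp: visibility_edges_def)
  ultimately have "card D \<le> card ?E" by (rule card_inj_on_le)
  also have "card D = (\<Sum>g\<in>gs. card ({..<n} - boundary k g))"
    unfolding D_def by (rule card_SigmaI) (auto simp: gs_def)
  also have "\<dots> = card ({..<n} - boundary k 1) + card ({..<n} - boundary k k) +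
      card ({..<n} - boundary k (k + 2)) + card ({..<n} - boundary k (2 * k - 1))"
    using \<open>k \<ge> 4\<close> unfolding gs_def by (subst sum.insert; auto)+
  finally have "card ({..<n} - boundary k 1) + card ({..<n} - boundary k k) +
      card ({..<n} - boundary k (k + 2)) + card ({..<n} - boundary k (2 * k - 1)) \<le> card ?E" .
  \<comment> \<open>This additive form also covers boundary sites with index \<open>n\<close> or
    more and avoids truncated subtraction.\<close>
  moreover have "n \<le> card ({..<n} - boundary k g) + card (boundary k g)" for g
    using diff_card_le_card_Diff[OF card_boundary(1)[OF assms(1)], of "{..<n}" g] by simp
  note this[of 1] this[of k] this[of "k + 2"] this[of "2 * k - 1"]
  ultimately show ?thesis
    using card_boundary(2-)[OF assms(1)] \<open>k \<ge> 4\<close> by linarith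
qed

theorem theorem6p7:
  fixes n :: nat
  assumes "n \<ge> 81"
  shows "\<exists>(V :: nat set) E.
           card V = n \<and> simple_graph V E \<and> bipartite V E \<and> URVG V E \<and>
           int (card E) \<ge> 4 * int n - 8 * \<lceil>sqrt (real n)\<rceil> + 4"
proof -
  define k where "k = nat \<lceil>sqrt (real n)\<rceil>"
  \<comment> \<open>This gives \<open>k \<ge> 9\<close>, hence the \<open>k \<ge> 4\<close> that
    keeps the four index distances distinct.\<close>
  have "sqrt (real n) \<ge> 9" using assms by (intro real_le_rsqrt) simp
  then have k: "int k = \<lceil>sqrt (real n)\<rceil>" and le: "sqrt (real n) \<le> real k"
    unfolding k_def by linarith+
  with le \<open>sqrt (real n) \<ge> 9\<close> have "k \<ge> 4" by linarith
  have "real n \<le> (real k)\<^sup>2" using le by (rule sqrt_le_D)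
  then have "n \<le> k\<^sup>2" by (metis of_nat_le_iff of_nat_power)
  let ?V = "{..<n}"
  let ?E = "visibility_edges ?V (layout k)"
  have "simple_graph ?V ?E" by (simp add: simple_graph_visibility_edges)
  moreover have "bipartite ?V ?E" using \<open>k \<ge> 4\<close> by (intro bipartite_visibility_edges) simp
  moreover have "URVG ?V ?E"
    unfolding URVG_def unit_square_representation_def
    using \<open>simple_graph ?V ?E\<close> layout_pairwise_disjoint
    by (intro conjI exI[of _ "layout k"] ballI impI mem_visibility_edges)
  moreover have "int (card ?E) \<ge> 4 * int n - 8 * \<lceil>sqrt (real n)\<rceil> + 4"
    using card_visibility_edges[OF \<open>k \<ge> 4\<close> \<open>n \<le> k\<^sup>2\<close>] unfolding k[symmetric] by linarith
  ultimately show ?thesis by (intro exI[of _ ?V] exI[of _ ?E]) simp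
qed

end
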